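(* Consider the control system $$\dot x(t)=f(x(t))+Bu(t)+w(t),\quad t\in[0,T],\quad x(0)=x_0\in\mathbb{R}^n,$$ and put $A=(\partial f/\partial x)(0)$. Let $T>0$, $\omega>0$, $M_d\ge 0$, $\delta\in\mathbb{R}$, a gain matrix $K\in\mathbb{R}^{m\times n}$ with associated constants $\tilde\lambda=\tilde\lambda(K)>0$ and $k_1\ge 1$, and constants $\Gamma_0>\|A\|$, $\varepsilon>0$ be as described in the context, and assume: 1. the pair $(A,B)$ is controllable; 2. if $M_d>0$, then $\delta<0$ and $k_1(\Gamma_0+T\|A\|)+\omega\le\tilde\lambda\le k_1T\|A\|+\omega-\delta$; if $M_d=0$, then $k_1(\Gamma_0+T\|A\|)+\omega\le\tilde\lambda$; 3. $|f(0)+w(t)|\le M_d\left(1-\frac{t}{T}\right)^{-\delta/\omega}$ for all $t\in[0,T]$, where $\delta<-k_1\Gamma_0$ if $M_d>0$, and $\delta=0$ if $M_d=0$; 4. with $\lambda^{**}=\tilde\lambda-k_1(\Gamma_0+T\|A\|)$ and $\gamma=\lambda^{**}+k_1\Gamma_0-\omega+\delta$ (where $\gamma<0$ in the case $M_d>0$), the equation $$k_1\mu+\left(e^{-\frac{k_1TM_d}{\gamma}}-1\right)\omega=\varepsilon$$ has a solution $\mu>0$. Then the system is locally null controllable.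
   Context: Standing setting: $f:\mathbb{R}^n\to\mathbb{R}^n$ is $C^2$, $B$ is a constant real $n\times m$ matrix, $x(t)\in\mathbb{R}^n$ is the state, $u(t)\in\mathbb{R}^m$ the (unconstrained) control, and $w:[0,T]\to\mathbb{R}^n$ is a continuous disturbance. It is assumed that trajectories of the system exist at least on $[0,T]$ for every $x_0$ and every continuous input $u$. $|\cdot|$ is the Euclidean norm and $\|\cdot\|$ the induced (spectral) matrix norm. The pair $(A,B)$ is controllable if $\operatorname{rank}(B,AB,\dots,A^{n-1}B)=n$. Local null controllability: there exist an open neighborhood $\mathcal{X}_0$ of the origin in $\mathbb{R}^n$ and a finite time $T>0$ such that to each $x_0\in\mathcal{X}_0$ there corresponds a continuous function $u:[0,T]\to\mathbb{R}^m$ such that the solution $x(t)$ of the system determined by this $u$ and $x(0)=x_0$ satisfies $x(T)=0$. (Here the time is the given $T$.) Constants. Let $R_2(a)=f(a)-f(0)-Aa$ be the Taylor remainder and $d(\tau)=w\bigl(T(1-e^{-\omega\tau})\bigr)$, $\tau\ge0$. Put $$\tilde R_\omega(a,\tau)=T\omega e^{-\omega\tau}R_2(a)-Aa+T\omega e^{-\omega\tau}\bigl(f(0)+d(\tau)\bigr).$$ The constants $\Gamma_0>\|A\|$ and $\varepsilon>0$ are such that $$|\tilde R_\omega(a,\tau)|\le\Gamma_0|a|+T\omega e^{-\omega\tau}|f(0)+d(\tau)|\quad\text{for all }|a|\le\varepsilon,\ \tau\ge0.$$ $K$ is a real $m\times n$ matrix such that the eigenvalues $\lambda_1,\dots,\lambda_n$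 of $A_{cl}=A+BK$ are pairwise distinct with negative real parts, $\tilde\lambda=\tilde\lambda(K)=-\max_i\Re(\lambda_i)>0$, and $k_1\ge1$ is a constant with $\|e^{A_{cl}\tau}\|\le k_1e^{-\tilde\lambda\tau}$ for all $\tau\ge0$. *)

theory Defs
  imports "HOL-Analysis.Analysis"
begin

abbreviation mat_norm :: "real^'n^'m \<Rightarrow> real"
  where "mat_norm M \<equiv> onorm ((*v) M)"

text \<open>The multiplication on the type of square matrices inherited from the pointwise product on
  vectors is not matrix multiplication, so \<open>(^)\<close> and \<open>exp\<close> cannot be used for matrices.\<close>

primrec mat_pow :: "real^'n^'n \<Rightarrow> nat \<Rightarrow> real^'n^'n"
  where
    "mat_pow M 0 = mat 1"
  | "mat_pow M (Suc k) = M ** mat_pow M k"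

definition mat_exp :: "real^'n^'n \<Rightarrow> real^'n^'n"
  where "mat_exp M = (\<Sum>k. (1 / fact k) *\<^sub>R mat_pow M k)"

definition complex_spectrum :: "real^'n^'n \<Rightarrow> complex set"
  where "complex_spectrum M =
    {z. \<exists>v :: complex^'n. v \<noteq> 0 \<and> map_matrix complex_of_real M *v v = z *s v}"

text \<open>The block matrix \<open>(B, AB, ..., A^(n-1) B)\<close>. Its columns are indexed by pairs: the first
  component selects the block, through the bijection \<open>to_nat_on UNIV\<close> from \<open>'n\<close> onto
  \<open>{..<CARD('n)}\<close>, and the second one the column inside the block. The order of the blocks is
  immaterial for the rank.\<close>

definition controllability_matrix :: "real^'n^'n \<Rightarrow> real^'m^'n \<Rightarrow> real^('n \<times> 'm)^'n"
  where "controllability_matrix A B =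
    (\<chi> i p. (mat_pow A (to_nat_on (UNIV :: 'n set) (fst p)) ** B) $ i $ snd p)"

definition controllable :: "real^'n^'n \<Rightarrow> real^'m^'n \<Rightarrow> bool"
  where "controllable A B \<longleftrightarrow> rank (controllability_matrix A B) = CARD('n)"

definition C2 :: "('a::real_normed_vector \<Rightarrow> 'b::real_normed_vector) \<Rightarrow> bool"
  where "C2 f \<longleftrightarrow> (\<exists>(f' :: 'a \<Rightarrow> 'a \<Rightarrow>\<^sub>L 'b) (f'' :: 'a \<Rightarrow> 'a \<Rightarrow>\<^sub>L 'a \<Rightarrow>\<^sub>L 'b).
    (\<forall>x. (f has_derivative blinfun_apply (f' x)) (at x)) \<and>
    (\<forall>x. (f' has_derivative blinfun_apply (f'' x)) (at x)) \<and>
    continuous_on UNIV f'')"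

definition is_trajectory ::
  "(real^'n \<Rightarrow> real^'n) \<Rightarrow> real^'m^'n \<Rightarrow> (real \<Rightarrow> real^'n) \<Rightarrow> real \<Rightarrow>
    (real \<Rightarrow> real^'m) \<Rightarrow> real^'n \<Rightarrow> (real \<Rightarrow> real^'n) \<Rightarrow> bool"
  where "is_trajectory f B w T u x\<^sub>0 x \<longleftrightarrow> x 0 = x\<^sub>0 \<and>
    (\<forall>t\<in>{0..T}. (x has_vector_derivative f (x t) + B *v u t + w t) (at t within {0..T}))"

text \<open>Trajectories are total functions of which only the values on \<open>{0..T}\<close> matter, so
  \<^emph>\<open>the\<close> solution is expressed by existence together with a statement about every trajectory.\<close>

definition locally_null_controllable ::
  "(real^'n \<Rightarrow> real^'n) \<Rightarrow> real^'m^'n \<Rightarrow> (real \<Rightarrow> real^'n) \<Rightarrow> real \<Rightarrow> bool"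
  where "locally_null_controllable f B w T \<longleftrightarrow> T > 0 \<and>
    (\<exists>X\<^sub>0. open X\<^sub>0 \<and> 0 \<in> X\<^sub>0 \<and>
      (\<forall>x\<^sub>0\<in>X\<^sub>0. \<exists>u. continuous_on {0..T} u \<and>
        (\<exists>x. is_trajectory f B w T u x\<^sub>0 x) \<and>
        (\<forall>x. is_trajectory f B w T u x\<^sub>0 x \<longrightarrow> x T = 0)))"

definition taylor_remainder :: "(real^'n \<Rightarrow> real^'n) \<Rightarrow> real^'n \<Rightarrow> real^'n"
  where "taylor_remainder f a = f a - f 0 - jacobian f (at 0) *v a"

text \<open>The disturbance in the new time \<open>\<tau> \<ge> 0\<close>, where \<open>t = T (1 - exp (- \<omega> \<tau>))\<close> lies in \<open>{0..<T}\<close>.\<close>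

definition rescaled_disturbance ::
  "(real \<Rightarrow> real^'n) \<Rightarrow> real \<Rightarrow> real \<Rightarrow> real \<Rightarrow> real^'n"
  where "rescaled_disturbance w T \<omega> \<tau> = w (T * (1 - exp (- \<omega> * \<tau>)))"

definition rescaled_remainder ::
  "(real^'n \<Rightarrow> real^'n) \<Rightarrow> (real \<Rightarrow> real^'n) \<Rightarrow> real \<Rightarrow> real \<Rightarrow> real^'n \<Rightarrow> real \<Rightarrow> real^'n"
  where "rescaled_remainder f w T \<omega> a \<tau> =
    (T * \<omega> * exp (- \<omega> * \<tau>)) *\<^sub>R taylor_remainder f a - jacobian f (at 0) *v a
      + (T * \<omega> * exp (- \<omega> * \<tau>)) *\<^sub>R (f 0 + rescaled_disturbance w T \<omega> \<tau>)"

lemma columns_controllability_matrix: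
  fixes A :: "real^'n^'n" and B :: "real^'m^'n"
  shows "columns (controllability_matrix A B) = (\<Union>k<CARD('n). columns (mat_pow A k ** B))"
proof -
  have bij: "bij_betw (to_nat_on (UNIV :: 'n set)) UNIV {..<CARD('n)}"
    by (rule to_nat_on_finite) simp
  have col: "column p (controllability_matrix A B)
      = column (snd p) (mat_pow A (to_nat_on (UNIV :: 'n set) (fst p)) ** B)" for p
    by (simp add: column_def controllability_matrix_def vec_eq_iff)
  have "columns (controllability_matrix A B) =
      (\<Union>j::'n. columns (mat_pow A (to_nat_on (UNIV :: 'n set) j) ** B))"
    by (auto simp: columns_def col)
  also have "\<dots> = (\<Union>k\<in>to_nat_on (UNIV :: 'n set) ` UNIV. columns (mat_pow A k ** B))"
    by blast
  finally show ?thesis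
    using bij by (metis bij_betw_imp_surj_on)
qed

lemma summable_mat_exp:
  fixes M :: "real^'n^'n"
  shows "summable (\<lambda>k. (1 / fact k) *\<^sub>R mat_pow M k)"
proof (rule summable_comparison_test'[where N = 0])
  let ?c = "real CARD('n) * real CARD('n)"
  have pow: "mat_norm (mat_pow M k) \<le> mat_norm M ^ k" for k
  proof (induction k)
    case 0
    have "(*v) (mat 1 :: real^'n^'n) = (\<lambda>x. x)" by auto
    then show ?case by (simp add: onorm_id_le)
  next
    case (Suc k)
    have "(*v) (mat_pow M (Suc k)) = (*v) M \<circ> (*v) (mat_pow M k)"
      by (auto simp: matrix_vector_mul_assoc)
    then have "mat_norm (mat_pow M (Suc k)) \<le> mat_norm M * mat_norm (mat_pow M k)"
      using onorm_compose[OF matrix_vector_mul_bounded_linear matrix_vector_mul_bounded_linear,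
          of M "mat_pow M k"] by simp
    also have "\<dots> \<le> mat_norm M * mat_norm M ^ k"
      using Suc by (intro mult_left_mono onorm_pos_le matrix_vector_mul_bounded_linear)
    finally show ?case by simp
  qed
  have entries: "norm N \<le> ?c * mat_norm N" for N :: "real^'n^'n"
  proof -
    have "norm N \<le> (\<Sum>i\<in>UNIV. norm (N $ i))"
      by (simp add: norm_vec_def L2_set_le_sum)
    also have "\<dots> \<le> (\<Sum>i\<in>(UNIV::'n set). \<Sum>j\<in>(UNIV::'n set). \<bar>N $ i $ j\<bar>)"
      by (intro sum_mono norm_le_l1_cart)
    also have "\<dots> \<le> (\<Sum>i\<in>(UNIV::'n set). \<Sum>j\<in>(UNIV::'n set). mat_norm N)"
      by (rule sum_mono, rule sum_mono, rule matrix_component_le_onorm)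
    finally show ?thesis by simp
  qed
  show "summable (\<lambda>k. ?c * (inverse (fact k) * mat_norm M ^ k))"
    by (rule summable_mult[OF summable_exp])
  fix k :: nat
  show "norm ((1 / fact k) *\<^sub>R mat_pow M k) \<le> ?c * (inverse (fact k) * mat_norm M ^ k)"
  proof -
    have "norm (mat_pow M k) \<le> ?c * mat_norm M ^ k"
      by (rule order_trans[OF entries mult_left_mono[OF pow]]) simp
    then have "inverse (fact k) * norm (mat_pow M k) \<le> inverse (fact k) * (?c * mat_norm M ^ k)"
      by (intro mult_left_mono) auto
    then show ?thesis by (simp add: field_simps)
  qed
qed

end

theory Submission
  imports Defs
begin

text \<open>Put \<open>M = A + B K\<close>. If \<open>M\<close> generates a semigroup with \<open>\<parallel>e\<^bsup>\<tau>M\<^esup>\<parallel> \<le> k e\<^bsup>-l\<tau>\<^esup>\<close>, then integrating the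
  derivative \<open>e\<^bsup>\<tau>M\<^esup> M v\<close> of \<open>e\<^bsup>\<tau>M\<^esup> v\<close> over \<open>\<tau> \<ge> 0\<close> gives \<open>l |v| \<le> k |M v|\<close>. A vector \<open>v\<close> in the
  kernel of \<open>B K\<close> has \<open>M v = A v\<close>, so that \<open>l |v| \<le> k \<parallel>A\<parallel> |v|\<close>. The gain conditions demand
  \<open>l \<ge> k (\<Gamma>\<^sub>0 + T \<parallel>A\<parallel>) + \<omega> > k \<parallel>A\<parallel>\<close>, because \<open>\<Gamma>\<^sub>0 > \<parallel>A\<parallel>\<close>; hence \<open>v = 0\<close>, the
  square matrix \<open>B K\<close> is invertible and \<open>B\<close> has a right inverse \<open>R\<close>. These two steps are
  \<open>generator_bounded_below_if_exponential_decay\<close> and \<open>right_invertible_if_fast_feedback\<close>.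

  A system with right invertible input matrix is fully actuated: every \<open>C\<^sup>1\<close> path \<open>p\<close> is a trajectory,
  produced by the continuous control \<open>u = R (p' - f p - w)\<close>. Steering along the segment from \<open>x\<^sub>0\<close> to the
  origin reaches \<open>0\<close> at time \<open>T\<close>, for \<^emph>\<open>every\<close> \<open>x\<^sub>0\<close>. The definition of null controllability speaks about
  all trajectories of this open-loop control, so uniqueness is needed as well; it follows from a
  Gronwall argument, because a \<open>C\<^sup>2\<close> map is Lipschitz on balls (\<open>is_trajectory_unique\<close>).\<close>

lemma mat_pow_Suc_right: "mat_pow M (Suc k) = mat_pow M k ** M"
  by (induction k) (simp_all add: matrix_mul_assoc)

lemma mat_pow_scaleR:
  fixes M :: "real^'n^'n"
  shows "mat_pow (t *\<^sub>R M) k = t ^ k *\<^sub>R mat_pow M k"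
  by (induction k)
    (simp_all add: matrix_matrix_mult_def vec_eq_iff sum_distrib_left mult_ac)

lemma mat_exp_0: "mat_exp (0 :: real^'n^'n) = mat 1"
proof -
  have "(\<lambda>k. (1 / fact k) *\<^sub>R mat_pow (0 :: real^'n^'n) k) = (\<lambda>k. if k = 0 then mat 1 else 0)"
  proof
    fix k show "(1 / fact k) *\<^sub>R mat_pow (0 :: real^'n^'n) k = (if k = 0 then mat 1 else 0)"
      by (cases k) (auto simp: matrix_matrix_mult_def vec_eq_iff)
  qed
  then show ?thesis
    using sums_single[of 0 "\<lambda>_. mat 1 :: real^'n^'n"] by (simp add: mat_exp_def sums_iff)
qed

lemma mat_exp_orbit_sums:
  fixes M :: "real^'n^'n"
  shows "(\<lambda>k. (mat_pow M k *v v) $ i / fact k * t ^ k) sums (mat_exp (t *\<^sub>R M) *v v) $ i"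
proof -
  have "linear (\<lambda>N :: real^'n^'n. (N *v v) $ i)"
    by (rule linearI) (simp_all add: matrix_vector_mult_add_rdistrib flip: scaleR_matrix_vector_assoc)
  then have "bounded_linear (\<lambda>N :: real^'n^'n. (N *v v) $ i)"
    by (simp add: linear_conv_bounded_linear)
  from bounded_linear.sums[OF this summable_sums[OF summable_mat_exp]]
  have "(\<lambda>k. (((1 / fact k) *\<^sub>R mat_pow (t *\<^sub>R M) k) *v v) $ i) sums (mat_exp (t *\<^sub>R M) *v v) $ i"
    unfolding mat_exp_def .
  then show ?thesis
    by (simp add: mat_pow_scaleR mult_ac flip: scaleR_matrix_vector_assoc)
qed

text \<open>Each coordinate of the orbit is an everywhere convergent real power series in \<open>t\<close>;
  differentiating it term by term shifts the matrix powers by one.\<close>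

lemma mat_exp_orbit_has_vector_derivative:
  fixes M :: "real^'n^'n"
  shows "((\<lambda>t. mat_exp (t *\<^sub>R M) *v v) has_vector_derivative mat_exp (t *\<^sub>R M) *v (M *v v)) (at t)"
proof -
  have "((\<lambda>t. (mat_exp (t *\<^sub>R M) *v v) $ i) has_real_derivative
      (mat_exp (t *\<^sub>R M) *v (M *v v)) $ i) (at t)" for i
  proof -
    define c where "c k = (mat_pow M k *v v) $ i / fact k" for k
    have "((\<lambda>t. \<Sum>k. c k * t ^ k) has_real_derivative (\<Sum>k. diffs c k * t ^ k)) (at t)"
      using mat_exp_orbit_sums[of M v i]
      by (intro termdiffs_strong_converges_everywhere) (auto simp: c_def sums_iff)
    moreover have "(\<Sum>k. c k * s ^ k) = (mat_exp (s *\<^sub>R M) *v v) $ i" for s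
      using mat_exp_orbit_sums[of M v i s] by (simp add: c_def sums_iff)
    moreover have "diffs c k = (mat_pow M k *v (M *v v)) $ i / fact k" for k
      unfolding diffs_def c_def mat_pow_Suc_right matrix_vector_mul_assoc
      by (simp add: fact_Suc del: of_nat_Suc)
    ultimately show ?thesis
      using mat_exp_orbit_sums[of M "M *v v" i t] by (simp add: sums_iff)
  qed
  then show ?thesis
    unfolding has_vector_derivative_def has_field_derivative_def
    by (subst has_derivative_componentwise_within)
      (auto simp: Basis_vec_def inner_axis mult_commute_abs)
qed

text \<open>A semigroup that decays at rate \<open>l\<close> forces its generator to be bounded below: for large \<open>\<tau>\<close> the
  orbit of \<open>v\<close> has lost the whole length of \<open>v\<close>, while its speed at time \<open>s\<close> is at most
  \<open>k e\<^bsup>-l s\<^esup> |M v|\<close>, which integrates to \<open>k |M v| / l\<close>.\<close>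

lemma generator_bounded_below_if_exponential_decay:
  fixes M :: "real^'n^'n"
  assumes decay: "\<And>\<tau>. \<tau> \<ge> 0 \<Longrightarrow> mat_norm (mat_exp (\<tau> *\<^sub>R M)) \<le> k * exp (- l * \<tau>)" and l: "l > 0"
  shows "l * norm v \<le> k * norm (M *v v)"
proof -
  define y where "y \<tau> = mat_exp (\<tau> *\<^sub>R M) *v v" for \<tau>
  have orbit: "norm (mat_exp (\<tau> *\<^sub>R M) *v a) \<le> k * exp (- l * \<tau>) * norm a" if "\<tau> \<ge> 0" for \<tau> a
    by (rule order_trans[OF onorm[OF matrix_vector_mul_bounded_linear]
          mult_right_mono[OF decay[OF that]]]) simp
  \<comment> \<open>An antiderivative of the bound on the speed, normalised to vanish at infinity.\<close>
  define \<phi> where "\<phi> \<tau> = - (k * norm (M *v v) / l * exp (- l * \<tau>))" for \<tau>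
  have y': "(y has_vector_derivative mat_exp (\<tau> *\<^sub>R M) *v (M *v v)) (at \<tau>)" for \<tau>
    unfolding y_def by (rule mat_exp_orbit_has_vector_derivative)
  have \<phi>': "(\<phi> has_vector_derivative k * exp (- l * \<tau>) * norm (M *v v)) (at \<tau>)" for \<tau>
    unfolding \<phi>_def has_real_derivative_iff_has_vector_derivative[symmetric]
    using l by (auto intro!: derivative_eq_intros)
  have travel: "norm v \<le> k * exp (- l * \<tau>) * norm v + k * norm (M *v v) / l * (1 - exp (- l * \<tau>))"
    if "\<tau> > 0" for \<tau>
  proof -
    have "norm (y \<tau> - y 0) \<le> \<phi> \<tau> - \<phi> 0"
    proof (rule differentiable_bound_general[OF that _ _ y' \<phi>'])
      show "continuous_on {0..\<tau>} y" "continuous_on {0..\<tau>} \<phi>"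
        by (intro continuous_at_imp_continuous_on ballI has_vector_derivative_continuous[OF y']
            has_vector_derivative_continuous[OF \<phi>'])+
    qed (use orbit in auto)
    moreover have "y 0 = v"
      by (simp add: y_def mat_exp_0)
    moreover have "norm (y \<tau>) \<le> k * exp (- l * \<tau>) * norm v"
      unfolding y_def using that by (intro orbit) simp
    moreover have "norm v \<le> norm (y \<tau>) + norm (y \<tau> - v)"
      by norm
    ultimately show ?thesis
      unfolding \<phi>_def by (simp add: right_diff_distrib)
  qed
  have "((\<lambda>\<tau>. exp (- l * \<tau>)) \<longlongrightarrow> 0) at_top"
    using l by (intro filterlim_compose[OF exp_at_bot] filterlim_tendsto_neg_mult_at_bot[OF tendsto_const])
      (auto simp: filterlim_ident)
  then have "((\<lambda>\<tau>. k * exp (- l * \<tau>) * norm v + k * norm (M *v v) / l * (1 - exp (- l * \<tau>)))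
      \<longlongrightarrow> k * 0 * norm v + k * norm (M *v v) / l * (1 - 0)) at_top"
    by (intro tendsto_intros)
  moreover have "\<forall>\<^sub>F \<tau> in at_top.
      norm v \<le> k * exp (- l * \<tau>) * norm v + k * norm (M *v v) / l * (1 - exp (- l * \<tau>))"
    by (rule eventually_mono[OF eventually_gt_at_top[of 0] travel])
  ultimately have "norm v \<le> k * 0 * norm v + k * norm (M *v v) / l * (1 - 0)"
    by (intro tendsto_lowerbound) auto
  then show ?thesis
    using l by (simp add: field_simps)
qed

text \<open>On the kernel of \<open>B K\<close> the feedback is invisible and the generator acts as \<open>A\<close>, which is too small
  for the lower bound \<open>l / k\<close> that the decay imposes. So \<open>B K\<close> is injective, being square it has a
  two-sided inverse \<open>Q\<close>, and \<open>K Q\<close> is a right inverse of \<open>B\<close>.\<close>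

lemma right_invertible_if_fast_feedback:
  fixes A :: "real^'n^'n" and B :: "real^'m^'n" and K :: "real^'n^'m"
  assumes decay: "\<And>\<tau>. \<tau> \<ge> 0 \<Longrightarrow> mat_norm (mat_exp (\<tau> *\<^sub>R (A + B ** K))) \<le> k * exp (- l * \<tau>)"
    and "k \<ge> 0" and fast: "k * mat_norm A < l"
  shows "\<exists>R. B ** R = mat 1"
proof -
  have "0 \<le> k * mat_norm A"
    using \<open>k \<ge> 0\<close> by (intro mult_nonneg_nonneg onorm_pos_le matrix_vector_mul_bounded_linear)
  with fast have "l > 0" by linarith
  have "v = 0" if "(B ** K) *v v = 0" for v
  proof (rule ccontr)
    assume "v \<noteq> 0"
    have "(A + B ** K) *v v = A *v v"
      using that by (simp add: matrix_vector_mult_add_rdistrib)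
    then have "l * norm v \<le> k * norm (A *v v)"
      using generator_bounded_below_if_exponential_decay[OF decay \<open>l > 0\<close>, of v] by simp
    also have "\<dots> \<le> k * (mat_norm A * norm v)"
      using \<open>k \<ge> 0\<close> by (intro mult_left_mono onorm matrix_vector_mul_bounded_linear)
    also have "\<dots> < l * norm v"
      using fast \<open>v \<noteq> 0\<close> by simp
    finally show False by simp
  qed
  then obtain Q where "Q ** (B ** K) = mat 1"
    using matrix_left_invertible_ker by blast
  then have "B ** (K ** Q) = mat 1"
    by (simp add: matrix_mul_assoc matrix_left_right_inverse)
  then show ?thesis by blast
qed

lemma C2_imp_continuous_on: "continuous_on S f" if "C2 f"
  using that unfolding C2_def
  by (meson continuous_at_imp_continuous_on has_derivative_continuous)

lemma C2_imp_lipschitz_on_cball: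
  fixes f :: "'a::euclidean_space \<Rightarrow> 'b::real_normed_vector"
  assumes "C2 f"
  shows "\<exists>L. \<forall>a\<in>cball 0 r. \<forall>b\<in>cball 0 r. norm (f a - f b) \<le> L * norm (a - b)"
proof -
  obtain f' f'' where f': "\<And>x. (f has_derivative blinfun_apply (f' x)) (at x)"
    and f'': "\<And>x. (f' has_derivative blinfun_apply (f'' x)) (at x)"
    using assms unfolding C2_def by blast
  have "continuous_on (cball 0 r) f'"
    by (meson continuous_at_imp_continuous_on has_derivative_continuous f'')
  then have "bounded (f' ` cball 0 r)"
    by (intro compact_imp_bounded compact_continuous_image compact_cball)
  then obtain L where L: "\<And>a. a \<in> cball 0 r \<Longrightarrow> norm (f' a) \<le> L"
    unfolding bounded_iff by blast
  have "norm (f a - f b) \<le> L * norm (a - b)" if "a \<in> cball 0 r" "b \<in> cball 0 r" for a b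
  proof (rule differentiable_bound[OF convex_cball _ _ that])
    show "(f has_derivative blinfun_apply (f' x)) (at x within cball 0 r)" for x
      by (rule has_derivative_at_withinI[OF f'])
    show "onorm (blinfun_apply (f' x)) \<le> L" if "x \<in> cball 0 r" for x
      using L[OF that] by (simp add: norm_blinfun.rep_eq)
  qed
  then show ?thesis by blast
qed

text \<open>Gronwall: two trajectories for the same input stay in a common ball, where \<open>f\<close> has a Lipschitz
  constant \<open>L\<close>. The control and the disturbance cancel in the difference \<open>e\<close>, so
  \<open>(|e|\<^sup>2)' \<le> 2 L |e|\<^sup>2\<close>, and \<open>e\<^bsup>-2Lt\<^esup> |e|\<^sup>2\<close> cannot increase from its initial value \<open>0\<close>.\<close>

lemma is_trajectory_unique:
  fixes f :: "real^'n \<Rightarrow> real^'n"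
  assumes "C2 f" and x: "is_trajectory f B w T u x\<^sub>0 x" and y: "is_trajectory f B w T u x\<^sub>0 y"
    and t: "t \<in> {0..T}"
  shows "x t = y t"
proof -
  have x': "(x has_vector_derivative f (x s) + B *v u s + w s) (at s within {0..T})"
    and y': "(y has_vector_derivative f (y s) + B *v u s + w s) (at s within {0..T})"
    if "s \<in> {0..T}" for s
    using x y that unfolding is_trajectory_def by auto
  have cont: "continuous_on {0..T} x" "continuous_on {0..T} y"
    unfolding continuous_on_eq_continuous_within
    by (intro ballI has_vector_derivative_continuous[OF x'] has_vector_derivative_continuous[OF y'];
        assumption)+
  then have "bounded (x ` {0..T} \<union> y ` {0..T})"
    by (simp add: compact_continuous_image compact_imp_bounded)
  then obtain r where r: "\<And>v. v \<in> x ` {0..T} \<union> y ` {0..T} \<Longrightarrow> norm v \<le> r"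
    unfolding bounded_iff by blast
  obtain L where L: "\<forall>a\<in>cball 0 r. \<forall>b\<in>cball 0 r. norm (f a - f b) \<le> L * norm (a - b)"
    using C2_imp_lipschitz_on_cball[OF \<open>C2 f\<close>] ..
  define e where "e s = x s - y s" for s
  define \<phi> where "\<phi> s = exp (- 2 * L * s) * (e s \<bullet> e s)" for s
  have "\<phi> t \<le> \<phi> 0"
  proof (rule DERIV_nonpos_imp_decreasing_open[where f = \<phi> and a = 0 and b = t])
    show "0 \<le> t" using t by simp
    have "continuous_on {0..t} x" "continuous_on {0..t} y"
      using cont t by (auto intro: continuous_on_subset)
    then show "continuous_on {0..t} \<phi>"
      unfolding \<phi>_def e_def by (intro continuous_intros)
    fix s assume s: "0 < s" "s < t"
    then have sT: "s \<in> {0..T}" and at: "at s within {0..T} = at s"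
      using t by (auto intro: at_within_Icc_at)
    define g where "g = f (x s) - f (y s)"
    have "(e has_vector_derivative g) (at s)"
      unfolding e_def g_def
      using has_vector_derivative_diff[OF x'[OF sT] y'[OF sT]] by (simp add: at)
    then have "(e has_derivative (\<lambda>h. h *\<^sub>R g)) (at s)"
      by (simp add: has_vector_derivative_def)
    from has_derivative_inner[OF this this]
    have "((\<lambda>s. e s \<bullet> e s) has_real_derivative 2 * (e s \<bullet> g)) (at s)"
      unfolding has_field_derivative_def
      by (rule has_derivative_eq_rhs) (auto simp: inner_commute algebra_simps)
    then have "(\<phi> has_real_derivative
        exp (- 2 * L * s) * (2 * (e s \<bullet> g) - 2 * L * (e s \<bullet> e s))) (at s)"
      unfolding \<phi>_def by (auto intro!: derivative_eq_intros simp: algebra_simps)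
    moreover have "e s \<bullet> g \<le> L * (e s \<bullet> e s)"
    proof -
      have "e s \<bullet> g \<le> norm (e s) * norm g"
        by (rule norm_cauchy_schwarz)
      also have "\<dots> \<le> norm (e s) * (L * norm (e s))"
        unfolding e_def g_def using r sT
        by (intro mult_left_mono bspec[OF bspec[OF L]]) auto
      finally show ?thesis
        by (simp add: dot_square_norm power2_eq_square mult_ac)
    qed
    ultimately show "\<exists>d. (\<phi> has_real_derivative d) (at s) \<and> d \<le> 0"
      by (auto intro!: exI mult_nonneg_nonpos)
  qed
  moreover have "\<phi> 0 = 0"
    using x y by (simp add: \<phi>_def e_def is_trajectory_def)
  ultimately have "e t \<bullet> e t \<le> 0"
    by (simp add: \<phi>_def mult_le_0_iff)
  then have "e t = 0"
    using inner_gt_zero_iff[of "e t"] by linarith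
  then show ?thesis
    by (simp add: e_def)
qed

text \<open>With a right inverse of \<open>B\<close> the velocity can be prescribed freely, so the straight segment to the
  origin is feasible from every initial state.\<close>

lemma locally_null_controllable_if_right_invertible:
  fixes f :: "real^'n \<Rightarrow> real^'n"
  assumes "C2 f" and w: "continuous_on {0..T} w" and "T > 0" and R: "B ** R = mat 1"
  shows "locally_null_controllable f B w T"
  unfolding locally_null_controllable_def
proof (intro conjI exI[of _ UNIV] ballI)
  fix x\<^sub>0 :: "real^'n"
  define p where "p t = (1 - t / T) *\<^sub>R x\<^sub>0" for t
  define u where "u t = R *v (- (1 / T) *\<^sub>R x\<^sub>0 - f (p t) - w t)" for t
  have "continuous_on {0..T} p"
    unfolding p_def using \<open>T > 0\<close> by (intro continuous_intros) auto
  then have "continuous_on {0..T} (\<lambda>t. - (1 / T) *\<^sub>R x\<^sub>0 - f (p t) - w t)"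
    by (intro continuous_intros w continuous_on_compose2[OF C2_imp_continuous_on[OF \<open>C2 f\<close>, of UNIV]]) auto
  then have u: "continuous_on {0..T} u"
    unfolding u_def by (rule linear_continuous_on_compose) (rule matrix_vector_mul_linear)
  have "B *v u t = - (1 / T) *\<^sub>R x\<^sub>0 - f (p t) - w t" for t
    unfolding u_def by (simp only: matrix_vector_mul_assoc R matrix_vector_mul_lid)
  moreover have "(p has_vector_derivative - (1 / T) *\<^sub>R x\<^sub>0) (at t within {0..T})" for t
    unfolding p_def using \<open>T > 0\<close> by (auto intro!: derivative_eq_intros)
  ultimately have p: "is_trajectory f B w T u x\<^sub>0 p"
    unfolding is_trajectory_def by (simp add: p_def)
  have "x T = 0" if "is_trajectory f B w T u x\<^sub>0 x" for x
    using is_trajectory_unique[OF \<open>C2 f\<close> that p, of T] \<open>T > 0\<close> by (simp add: p_def)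
  with u p show "\<exists>u. continuous_on {0..T} u \<and> (\<exists>x. is_trajectory f B w T u x\<^sub>0 x) \<and>
      (\<forall>x. is_trajectory f B w T u x\<^sub>0 x \<longrightarrow> x T = 0)"
    by blast
qed (use \<open>T > 0\<close> in auto)

theorem theorem3p4:
  fixes f :: "real^'n \<Rightarrow> real^'n"
    and B :: "real^'m^'n"
    and w :: "real \<Rightarrow> real^'n"
    and K :: "real^'n^'m"
    and A A\<^sub>c\<^sub>l :: "real^'n^'n"
    and ev :: "'n \<Rightarrow> complex"
    and T \<omega> M\<^sub>d \<delta> \<Gamma>\<^sub>0 \<epsilon> lt k\<^sub>1 lss \<gamma> :: real
  assumes f_C2: "C2 f"
    and w_cont: "continuous_on {0..T} w"
    and T_pos: "T > 0"
    and \<omega>_pos: "\<omega> > 0"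
    and Md_nonneg: "M\<^sub>d \<ge> 0"
    and trajectories_exist:
      "\<And>x\<^sub>0 u. continuous_on {0..T} u \<Longrightarrow> \<exists>x. is_trajectory f B w T u x\<^sub>0 x"
    and A_eq: "A = jacobian f (at 0)"
    and \<Gamma>\<^sub>0_gt: "\<Gamma>\<^sub>0 > mat_norm A"
    and \<epsilon>_pos: "\<epsilon> > 0"
    and remainder_bound: "\<And>a \<tau>. norm a \<le> \<epsilon> \<Longrightarrow> \<tau> \<ge> 0 \<Longrightarrow>
      norm (rescaled_remainder f w T \<omega> a \<tau>)
        \<le> \<Gamma>\<^sub>0 * norm a + T * \<omega> * exp (- \<omega> * \<tau>) * norm (f 0 + rescaled_disturbance w T \<omega> \<tau>)"
    and Acl_eq: "A\<^sub>c\<^sub>l = A + B ** K"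
    and eigenvalues: "range ev = complex_spectrum A\<^sub>c\<^sub>l"
    and eigenvalues_distinct: "inj ev"
    and eigenvalues_neg: "\<And>i. Re (ev i) < 0"
    and lt_eq: "lt = - (MAX i. Re (ev i))"
    and k1_ge: "k\<^sub>1 \<ge> 1"
    and exp_bound: "\<And>\<tau>. \<tau> \<ge> 0 \<Longrightarrow> mat_norm (mat_exp (\<tau> *\<^sub>R A\<^sub>c\<^sub>l)) \<le> k\<^sub>1 * exp (- lt * \<tau>)"
    and cond1: "controllable A B"
    and cond2_pos: "M\<^sub>d > 0 \<Longrightarrow> \<delta> < 0 \<and> k\<^sub>1 * (\<Gamma>\<^sub>0 + T * mat_norm A) + \<omega> \<le> lt
        \<and> lt \<le> k\<^sub>1 * T * mat_norm A + \<omega> - \<delta>"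
    and cond2_zero: "M\<^sub>d = 0 \<Longrightarrow> k\<^sub>1 * (\<Gamma>\<^sub>0 + T * mat_norm A) + \<omega> \<le> lt"
    and cond3: "\<And>t. t \<in> {0..T} \<Longrightarrow> norm (f 0 + w t) \<le> M\<^sub>d * (1 - t / T) powr (- \<delta> / \<omega>)"
    and cond3_pos: "M\<^sub>d > 0 \<Longrightarrow> \<delta> < - k\<^sub>1 * \<Gamma>\<^sub>0"
    and cond3_zero: "M\<^sub>d = 0 \<Longrightarrow> \<delta> = 0"
    and lss_eq: "lss = lt - k\<^sub>1 * (\<Gamma>\<^sub>0 + T * mat_norm A)"
    and \<gamma>_eq: "\<gamma> = lss + k\<^sub>1 * \<Gamma>\<^sub>0 - \<omega> + \<delta>"
    and \<gamma>_neg: "M\<^sub>d > 0 \<Longrightarrow> \<gamma> < 0"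
    and cond4: "\<exists>\<mu>>0. k\<^sub>1 * \<mu> + (exp (- (k\<^sub>1 * T * M\<^sub>d / \<gamma>)) - 1) * \<omega> = \<epsilon>"
  shows "locally_null_controllable f B w T"
proof -
  have norm_A: "0 \<le> mat_norm A"
    by (rule onorm_pos_le[OF matrix_vector_mul_bounded_linear])
  have gain: "k\<^sub>1 * (\<Gamma>\<^sub>0 + T * mat_norm A) + \<omega> \<le> lt"
    using cond2_pos cond2_zero Md_nonneg by (cases "M\<^sub>d = 0") auto
  have "k\<^sub>1 * mat_norm A \<le> k\<^sub>1 * (\<Gamma>\<^sub>0 + T * mat_norm A)"
    using k1_ge \<Gamma>\<^sub>0_gt T_pos norm_A by (intro mult_left_mono) (auto intro: add_increasing2)
  with gain \<omega>_pos have "k\<^sub>1 * mat_norm A < lt"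
    by linarith
  then obtain R where "B ** R = mat 1"
    using right_invertible_if_fast_feedback[OF exp_bound[unfolded Acl_eq]] k1_ge by auto
  then show ?thesis
    using locally_null_controllable_if_right_invertible f_C2 w_cont T_pos by blast
qed

end
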